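(* The restriction of $\mathrm{Sd}$ to the category of small groupoids is conservative. More precisely: let $F:\mathscr G\to\mathscr H$ be a functor between small groupoids such that $\Psi:=\mathrm{Sd}\,F:\mathrm{Sd}\,\mathscr G\to\mathrm{Sd}\,\mathscr H$ is an isomorphism of categories, and let $\psi$ be the map from objects and morphisms of $\mathscr G$ to objects and morphisms of $\mathscr H$ induced by $\Psi$. Then $\psi a=Fa$ for every object $a$ and $\psi g=Fg$ for every morphism $g$ of $\mathscr G$, and $F$ is an isomorphism of categories.
   Context: For $n\ge 0$, $[n]$ denotes the poset category $0<1<\cdots<n$, and $\mathbf\Delta$ is the full subcategory of $\mathbf{Cat}$ on the $[n]$; its morphisms are the order-preserving maps, its monomorphisms the injective ones and its epimorphisms the surjective ones. For a small category $\mathscr C$, an $n$-simplex of the nerve $N\mathscr C$ is a functor $x:[n]\to\mathscr C$, and $\mu^*x=x\circ\mu$ for $\mu:[m]\to[n]$ in $\mathbf\Delta$. A simplex $y$ is degenerate if $y=\sigma^*x$ for some simplex $x$ and some non-identity epimorphism $\sigma$ of $\mathbf\Delta$ (equivalently, some arrow $y([i-1<i])$ is an identity). For each simplex $y$ there is a unique non-degenerate simplex $\lambda(y)$ (the non-degenerate root) and a unique epimorphism $\omega(y)$ in $\mathbf\Delta$ with $\omega(y)^*\lambda(y)=y$. The subdivision $\mathrm{Sd}\,\mathscr C$ is the category whose objects are the non-degenerate simplices (of all dimensions $\ge 0$) of $N\mathscr C$. A morphism from $x:[m]\to\mathscr C$ to $y:[n]\to\mathscr C$ is a pair $(\sigma,\nu)$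 of morphisms of $\mathbf\Delta$ with a common domain $[k]$, where $\sigma:[k]\to[m]$ is an epimorphism, $\nu:[k]\to[n]$ is a monomorphism, and $\sigma^*x=\nu^*y$. Such a pair is determined by the binary relation (multivalued function) $\nu\circ\sigma^{-1}$ from $\{0,\ldots,m\}$ to $\{0,\ldots,n\}$, and composition in $\mathrm{Sd}\,\mathscr C$ is composition of these relations. For a functor $F:\mathscr B\to\mathscr C$, the functor $\mathrm{Sd}\,F:\mathrm{Sd}\,\mathscr B\to\mathrm{Sd}\,\mathscr C$ sends a non-degenerate simplex $x$ to $\lambda(F\circ x)$, and sends a morphism $(\sigma,\nu):x\to y$ to the morphism $\lambda(F\circ x)\to\lambda(F\circ y)$ whose associated relation is $\omega(F\circ y)\circ\nu\circ\sigma^{-1}\circ\omega(F\circ x)^{-1}$. $\langle a\rangle$ denotes the $0$-simplex representing an object $a$, and $\prec f\succ$ the $1$-simplex $[1]\to\mathscr C$ sending the arrow $0\to1$ to $f$. Any isomorphism $\Psi:\mathrm{Sd}\,\mathscr B\to\mathrm{Sd}\,\mathscr C$ carries $m$-simplices bijectively to $m$-simplices for each $m$; the induced map $\psi$ on objects and morphisms is the unique one with $\Psi\langle b\rangle=\langle\psi b\rangle$ and $\psi(\mathrm{id}_b)=\mathrm{id}_{\psi b}$ for every object $b$, and $\Psi\prec f\succ=\prec\psi f\succ$ for every non-identity morphism $f$. *)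

theory Defs
  imports Main "HOL-Library.FuncSet"
begin

section \<open>Small categories, functors, groupoids\<close>

text \<open>\<open>Comp C g f\<close> is the composite \<open>g \<circ> f\<close> (first \<open>f\<close>, then \<open>g\<close>).\<close>

record ('o, 'a) cat =
  Ob :: "'o set"
  Ar :: "'a set"
  Dom :: "'a \<Rightarrow> 'o"
  Cod :: "'a \<Rightarrow> 'o"
  Id :: "'o \<Rightarrow> 'a"
  Comp :: "'a \<Rightarrow> 'a \<Rightarrow> 'a"

definition category :: "('o, 'a) cat \<Rightarrow> bool" where
  "category C \<longleftrightarrow>
     (\<forall>f\<in>Ar C. Dom C f \<in> Ob C \<and> Cod C f \<in> Ob C) \<and>
     (\<forall>a\<in>Ob C. Id C a \<in> Ar C \<and> Dom C (Id C a) = a \<and> Cod C (Id C a) = a) \<and>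
     (\<forall>f\<in>Ar C. \<forall>g\<in>Ar C. Dom C g = Cod C f \<longrightarrow>
        Comp C g f \<in> Ar C \<and> Dom C (Comp C g f) = Dom C f \<and> Cod C (Comp C g f) = Cod C g) \<and>
     (\<forall>f\<in>Ar C. Comp C f (Id C (Dom C f)) = f \<and> Comp C (Id C (Cod C f)) f = f) \<and>
     (\<forall>f\<in>Ar C. \<forall>g\<in>Ar C. \<forall>h\<in>Ar C. Dom C g = Cod C f \<longrightarrow> Dom C h = Cod C g \<longrightarrow>
        Comp C h (Comp C g f) = Comp C (Comp C h g) f)"

definition groupoid :: "('o, 'a) cat \<Rightarrow> bool" where
  "groupoid C \<longleftrightarrow> category C \<and>
     (\<forall>f\<in>Ar C. \<exists>g\<in>Ar C. Dom C g = Cod C f \<and> Cod C g = Dom C f \<and>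
        Comp C g f = Id C (Dom C f) \<and> Comp C f g = Id C (Cod C f))"

text \<open>
  The maps making up a functor are extensional (\<open>undefined\<close> off the objects and arrows of the
  source), so that equality of functors between given categories is equality in HOL.
\<close>

record ('o, 'a, 'p, 'b) cat_map =
  on_ob :: "'o \<Rightarrow> 'p"
  on_ar :: "'a \<Rightarrow> 'b"

definition is_functor :: "('o, 'a) cat \<Rightarrow> ('p, 'b) cat \<Rightarrow> ('o, 'a, 'p, 'b) cat_map \<Rightarrow> bool" where
  "is_functor A B F \<longleftrightarrow>
     on_ob F \<in> Ob A \<rightarrow>\<^sub>E Ob B \<and>
     on_ar F \<in> Ar A \<rightarrow>\<^sub>E Ar B \<and>
     (\<forall>f\<in>Ar A. Dom B (on_ar F f) = on_ob F (Dom A f) \<and> Cod B (on_ar F f) = on_ob F (Cod A f)) \<and>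
     (\<forall>a\<in>Ob A. on_ar F (Id A a) = Id B (on_ob F a)) \<and>
     (\<forall>f\<in>Ar A. \<forall>g\<in>Ar A. Dom A g = Cod A f \<longrightarrow>
        on_ar F (Comp A g f) = Comp B (on_ar F g) (on_ar F f))"

definition id_functor :: "('o, 'a) cat \<Rightarrow> ('o, 'a, 'o, 'a) cat_map" where
  "id_functor A = \<lparr> on_ob = (\<lambda>a\<in>Ob A. a), on_ar = (\<lambda>f\<in>Ar A. f) \<rparr>"

text \<open>\<open>comp_functor A K F\<close> is \<open>K \<circ> F\<close>, where \<open>A\<close> is the source of \<open>F\<close>.\<close>

definition comp_functor :: "('o, 'a) cat \<Rightarrow> ('p, 'b, 'q, 'c) cat_map \<Rightarrow> ('o, 'a, 'p, 'b) cat_map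
    \<Rightarrow> ('o, 'a, 'q, 'c) cat_map" where
  "comp_functor A K F =
     \<lparr> on_ob = compose (Ob A) (on_ob K) (on_ob F), on_ar = compose (Ar A) (on_ar K) (on_ar F) \<rparr>"

definition is_isomorphism :: "('o, 'a) cat \<Rightarrow> ('p, 'b) cat \<Rightarrow> ('o, 'a, 'p, 'b) cat_map \<Rightarrow> bool" where
  "is_isomorphism A B F \<longleftrightarrow> is_functor A B F \<and>
     (\<exists>K. is_functor B A K \<and> comp_functor A K F = id_functor A \<and> comp_functor B F K = id_functor B)"


section \<open>The simplex category\<close>

text \<open>The poset category \<open>[n]\<close>; its unique arrow \<open>i \<rightarrow> j\<close>, for \<open>i \<le> j\<close>, is the pair \<open>(i, j)\<close>.\<close>

definition ordcat :: "nat \<Rightarrow> (nat, nat \<times> nat) cat" where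
  "ordcat n = \<lparr> Ob = {..n}, Ar = {(i, j). i \<le> j \<and> j \<le> n}, Dom = fst, Cod = snd,
                Id = (\<lambda>i. (i, i)), Comp = (\<lambda>g f. (fst f, snd g)) \<rparr>"

definition delta :: "nat \<Rightarrow> nat \<Rightarrow> (nat \<Rightarrow> nat) set" where
  "delta m n = {\<mu> \<in> {..m} \<rightarrow>\<^sub>E {..n}. mono_on {..m} \<mu>}"

definition delta_mono :: "nat \<Rightarrow> nat \<Rightarrow> (nat \<Rightarrow> nat) set" where
  "delta_mono m n = {\<mu> \<in> delta m n. inj_on \<mu> {..m}}"

definition delta_epi :: "nat \<Rightarrow> nat \<Rightarrow> (nat \<Rightarrow> nat) set" where
  "delta_epi m n = {\<mu> \<in> delta m n. \<mu> ` {..m} = {..n}}"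

definition delta_id :: "nat \<Rightarrow> nat \<Rightarrow> nat" where
  "delta_id n = (\<lambda>i\<in>{..n}. i)"

definition ord_functor :: "nat \<Rightarrow> (nat \<Rightarrow> nat) \<Rightarrow> (nat, nat \<times> nat, nat, nat \<times> nat) cat_map" where
  "ord_functor m \<mu> =
     \<lparr> on_ob = (\<lambda>i\<in>Ob (ordcat m). \<mu> i), on_ar = (\<lambda>(i, j)\<in>Ar (ordcat m). (\<mu> i, \<mu> j)) \<rparr>"


section \<open>Simplices of the nerve\<close>

text \<open>
  A simplex carries its dimension explicitly: if the category has just one object, its type may
  have just one element, and the underlying functions then do not determine the dimension.
\<close>

type_synonym ('o, 'a) simplex = "nat \<times> (nat, nat \<times> nat, 'o, 'a) cat_map"

abbreviation sdim :: "('o, 'a) simplex \<Rightarrow> nat" where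
  "sdim \<equiv> fst"

definition nerve :: "('o, 'a) cat \<Rightarrow> ('o, 'a) simplex set" where
  "nerve C = {(n, x). is_functor (ordcat n) C x}"

text \<open>\<open>pull m \<mu> x\<close> is \<open>\<mu>\<^sup>*x = x \<circ> \<mu>\<close> for \<open>\<mu> : [m] \<rightarrow> [sdim x]\<close>.\<close>

definition pull :: "nat \<Rightarrow> (nat \<Rightarrow> nat) \<Rightarrow> ('o, 'a) simplex \<Rightarrow> ('o, 'a) simplex" where
  "pull m \<mu> x = (m, comp_functor (ordcat m) (snd x) (ord_functor m \<mu>))"

text \<open>The simplex \<open>F \<circ> x\<close>.\<close>

definition push :: "('o, 'a, 'p, 'b) cat_map \<Rightarrow> ('o, 'a) simplex \<Rightarrow> ('p, 'b) simplex" where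
  "push F x = (sdim x, comp_functor (ordcat (sdim x)) F (snd x))"

definition degenerate :: "('o, 'a) cat \<Rightarrow> ('o, 'a) simplex \<Rightarrow> bool" where
  "degenerate C y \<longleftrightarrow>
     (\<exists>x\<in>nerve C. \<exists>\<sigma>\<in>delta_epi (sdim y) (sdim x).
        \<not> (sdim x = sdim y \<and> \<sigma> = delta_id (sdim y)) \<and> y = pull (sdim y) \<sigma> x)"

definition nondegenerate_simplices :: "('o, 'a) cat \<Rightarrow> ('o, 'a) simplex set" where
  "nondegenerate_simplices C = {x \<in> nerve C. \<not> degenerate C x}"

text \<open>The non-degenerate root \<open>\<lambda>(y)\<close> and the epimorphism \<open>\<omega>(y)\<close>.\<close>

definition root :: "('o, 'a) cat \<Rightarrow> ('o, 'a) simplex \<Rightarrow> ('o, 'a) simplex" where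
  "root C y = (THE x. x \<in> nondegenerate_simplices C \<and>
                 (\<exists>\<sigma>\<in>delta_epi (sdim y) (sdim x). pull (sdim y) \<sigma> x = y))"

definition root_epi :: "('o, 'a) cat \<Rightarrow> ('o, 'a) simplex \<Rightarrow> (nat \<Rightarrow> nat)" where
  "root_epi C y = (THE \<sigma>. \<sigma> \<in> delta_epi (sdim y) (sdim (root C y)) \<and>
                     pull (sdim y) \<sigma> (root C y) = y)"

text \<open>The simplices \<open>\<langle>a\<rangle>\<close> and \<open>\<prec>f\<succ>\<close>.\<close>

definition simplex0 :: "('o, 'a) cat \<Rightarrow> 'o \<Rightarrow> ('o, 'a) simplex" where
  "simplex0 C a = (0, \<lparr> on_ob = (\<lambda>i\<in>Ob (ordcat 0). a), on_ar = (\<lambda>p\<in>Ar (ordcat 0). Id C a) \<rparr>)"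

definition simplex1 :: "('o, 'a) cat \<Rightarrow> 'a \<Rightarrow> ('o, 'a) simplex" where
  "simplex1 C f = (1,
     \<lparr> on_ob = (\<lambda>i\<in>Ob (ordcat 1). if i = 0 then Dom C f else Cod C f),
       on_ar = (\<lambda>p\<in>Ar (ordcat 1). if p = (0, 1) then f
                                  else if p = (0, 0) then Id C (Dom C f)
                                  else Id C (Cod C f)) \<rparr>)"


section \<open>Subdivision\<close>

text \<open>
  A morphism of \<open>Sd C\<close> is a pair \<open>(sd_epi, sd_mono)\<close> of maps with common domain \<open>[sd_apex]\<close>,
  together with its source and target simplex.
\<close>

record ('o, 'a) sd_arrow =
  sd_src :: "('o, 'a) simplex"
  sd_tgt :: "('o, 'a) simplex"
  sd_apex :: nat
  sd_epi :: "nat \<Rightarrow> nat"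
  sd_mono :: "nat \<Rightarrow> nat"

definition sd_arrows :: "('o, 'a) cat \<Rightarrow> ('o, 'a) sd_arrow set" where
  "sd_arrows C = {f.
     sd_src f \<in> nondegenerate_simplices C \<and> sd_tgt f \<in> nondegenerate_simplices C \<and>
     sd_epi f \<in> delta_epi (sd_apex f) (sdim (sd_src f)) \<and>
     sd_mono f \<in> delta_mono (sd_apex f) (sdim (sd_tgt f)) \<and>
     pull (sd_apex f) (sd_epi f) (sd_src f) = pull (sd_apex f) (sd_mono f) (sd_tgt f)}"

definition graph_on :: "nat \<Rightarrow> (nat \<Rightarrow> nat) \<Rightarrow> (nat \<times> nat) set" where
  "graph_on k \<mu> = {(i, \<mu> i) | i. i \<le> k}"

text \<open>
  The relation \<open>\<nu> \<circ> \<sigma>\<inverse>\<close>. Note that \<open>R O S\<close> means first \<open>R\<close>, then \<open>S\<close>, the reverse of the order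
  used for \<open>\<circ>\<close>.
\<close>

definition sd_rel :: "('o, 'a) sd_arrow \<Rightarrow> (nat \<times> nat) set" where
  "sd_rel f = (graph_on (sd_apex f) (sd_epi f))\<inverse> O graph_on (sd_apex f) (sd_mono f)"

definition sd_arrow_of_rel :: "('o, 'a) cat \<Rightarrow> ('o, 'a) simplex \<Rightarrow> ('o, 'a) simplex
    \<Rightarrow> (nat \<times> nat) set \<Rightarrow> ('o, 'a) sd_arrow" where
  "sd_arrow_of_rel C x y R =
     (THE f. f \<in> sd_arrows C \<and> sd_src f = x \<and> sd_tgt f = y \<and> sd_rel f = R)"

definition Sd :: "('o, 'a) cat \<Rightarrow> (('o, 'a) simplex, ('o, 'a) sd_arrow) cat" where
  "Sd C = \<lparr> Ob = nondegenerate_simplices C,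
            Ar = sd_arrows C,
            Dom = sd_src,
            Cod = sd_tgt,
            Id = (\<lambda>x. \<lparr> sd_src = x, sd_tgt = x, sd_apex = sdim x,
                        sd_epi = delta_id (sdim x), sd_mono = delta_id (sdim x) \<rparr>),
            Comp = (\<lambda>g f. sd_arrow_of_rel C (sd_src f) (sd_tgt g) (sd_rel f O sd_rel g)) \<rparr>"

definition Sd_map :: "('o, 'a) cat \<Rightarrow> ('p, 'b) cat \<Rightarrow> ('o, 'a, 'p, 'b) cat_map
    \<Rightarrow> (('o, 'a) simplex, ('o, 'a) sd_arrow, ('p, 'b) simplex, ('p, 'b) sd_arrow) cat_map" where
  "Sd_map B C F =
     \<lparr> on_ob = (\<lambda>x\<in>Ob (Sd B). root C (push F x)),
       on_ar = (\<lambda>f\<in>Ar (Sd B).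
         let Fx = push F (sd_src f); Fy = push F (sd_tgt f) in
         sd_arrow_of_rel C (root C Fx) (root C Fy)
           ((graph_on (sdim Fx) (root_epi C Fx))\<inverse> O sd_rel f O graph_on (sdim Fy) (root_epi C Fy))) \<rparr>"


section \<open>The map induced by an isomorphism of subdivisions\<close>

definition is_induced_map :: "('o, 'a) cat \<Rightarrow> ('p, 'b) cat
    \<Rightarrow> (('o, 'a) simplex, ('o, 'a) sd_arrow, ('p, 'b) simplex, ('p, 'b) sd_arrow) cat_map
    \<Rightarrow> ('o, 'a, 'p, 'b) cat_map \<Rightarrow> bool" where
  "is_induced_map B C \<Psi> \<psi> \<longleftrightarrow>
     on_ob \<psi> \<in> Ob B \<rightarrow>\<^sub>E Ob C \<and>
     on_ar \<psi> \<in> Ar B \<rightarrow>\<^sub>E Ar C \<and>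
     (\<forall>b\<in>Ob B. on_ob \<Psi> (simplex0 B b) = simplex0 C (on_ob \<psi> b)) \<and>
     (\<forall>b\<in>Ob B. on_ar \<psi> (Id B b) = Id C (on_ob \<psi> b)) \<and>
     (\<forall>f\<in>Ar B - Id B ` Ob B. on_ob \<Psi> (simplex1 B f) = simplex1 C (on_ar \<psi> f))"

definition induced_map :: "('o, 'a) cat \<Rightarrow> ('p, 'b) cat
    \<Rightarrow> (('o, 'a) simplex, ('o, 'a) sd_arrow, ('p, 'b) simplex, ('p, 'b) sd_arrow) cat_map
    \<Rightarrow> ('o, 'a, 'p, 'b) cat_map" where
  "induced_map B C \<Psi> = (THE \<psi>. is_induced_map B C \<Psi> \<psi>)"

end

theory Submission
  imports Defs
begin

text \<open>
  Since \<open>Sd F\<close> is an isomorphism, it is bijective on non-degenerate simplices, and the values of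
  \<open>F\<close> are read off from simplices of dimension at most \<open>1\<close>.

  A vertex \<open>\<langle>a\<rangle>\<close> goes to \<open>\<langle>Fa\<rangle>\<close>. If \<open>F\<close> sent a non-identity arrow \<open>f : a \<rightarrow> b\<close> to an identity, the
  root of \<open>F \<circ> \<prec>f\<succ>\<close> would be \<open>\<langle>Fa\<rangle>\<close>, so \<open>\<prec>f\<succ>\<close> and \<open>\<langle>a\<rangle>\<close> would have the same image under the
  injective map \<open>Sd F\<close> (\<open>Sd_map_inj_reflects_identities\<close>). Hence \<open>F \<circ> \<prec>f\<succ>\<close> is non-degenerate
  and \<open>\<prec>f\<succ>\<close> goes to \<open>\<prec>Ff\<succ>\<close>. Thus \<open>F\<close> satisfies the conditions that characterise the induced map
  \<open>\<psi>\<close>, so \<open>\<psi> = F\<close> (\<open>induced_map_Sd_map\<close>), and \<open>F\<close> is injective on objects and on arrows.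

  For surjectivity, let \<open>x\<close> be the simplex with \<open>Sd F x = \<prec>h\<succ>\<close>. It is not known beforehand that
  \<open>x\<close> has dimension \<open>1\<close>, but it has positive dimension, because vertices go to vertices; so its
  first arrow \<open>f\<close> is not an identity
  (\<open>first_arrow_not_identity\<close>) and \<open>\<prec>f\<succ>\<close> is a face of \<open>x\<close>. Faces are arrows of the subdivision,
  so there is an arrow from \<open>Sd F \<prec>f\<succ> = \<prec>Ff\<succ>\<close> to \<open>\<prec>h\<succ>\<close>. An arrow between simplices of the same
  dimension is trivial (\<open>sd_arrow_same_dim\<close>), whence \<open>Ff = h\<close>. The same argument with a vertex of
  the preimage shows surjectivity on objects. A functor bijective on objects and on arrows is an
  isomorphism.
\<close>

section \<open>Functors\<close>

lemma functor_eqI: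
  assumes "is_functor A B F" and "is_functor A B K"
    and "\<And>a. a \<in> Ob A \<Longrightarrow> on_ob F a = on_ob K a"
    and "\<And>f. f \<in> Ar A \<Longrightarrow> on_ar F f = on_ar K f"
  shows "F = K"
proof -
  have "on_ob F = on_ob K" "on_ar F = on_ar K"
    using assms by (auto simp: is_functor_def intro: PiE_ext)
  then show ?thesis by (cases F, cases K) simp
qed

lemma comp_functor_is_functor:
  assumes A: "category A" and F: "is_functor A B F" and K: "is_functor B C K"
  shows "is_functor A C (comp_functor A K F)"
proof -
  have ob: "\<And>a. a \<in> Ob A \<Longrightarrow> on_ob F a \<in> Ob B" and ar: "\<And>f. f \<in> Ar A \<Longrightarrow> on_ar F f \<in> Ar B"
    using F by (auto simp: is_functor_def)
  have "on_ob (comp_functor A K F) \<in> Ob A \<rightarrow>\<^sub>E Ob C" "on_ar (comp_functor A K F) \<in> Ar A \<rightarrow>\<^sub>E Ar C"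
    using ob ar K by (auto simp: comp_functor_def compose_def is_functor_def)
  then show ?thesis
    using A F K ob ar unfolding is_functor_def category_def
    by (simp add: comp_functor_def compose_def)
qed

lemma bijective_functor_is_isomorphism:
  assumes A: "category A" and F: "is_functor A B F"
    and ob: "bij_betw (on_ob F) (Ob A) (Ob B)" and ar: "bij_betw (on_ar F) (Ar A) (Ar B)"
  shows "is_isomorphism A B F"
proof -
  define K where "K = \<lparr> on_ob = (\<lambda>b\<in>Ob B. inv_into (Ob A) (on_ob F) b),
                        on_ar = (\<lambda>g\<in>Ar B. inv_into (Ar A) (on_ar F) g) \<rparr>"
  have KF_ob: "on_ob K (on_ob F a) = a" "on_ob F a \<in> Ob B" if "a \<in> Ob A" for a
    using that ob by (auto simp: K_def bij_betw_def)
  have KF_ar: "on_ar K (on_ar F f) = f" "on_ar F f \<in> Ar B" if "f \<in> Ar A" for f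
    using that ar by (auto simp: K_def bij_betw_def)
  have ob_cases: "\<exists>a\<in>Ob A. b = on_ob F a" if "b \<in> Ob B" for b
    using that ob by (auto simp: bij_betw_def)
  have ar_cases: "\<exists>f\<in>Ar A. g = on_ar F f" if "g \<in> Ar B" for g
    using that ar by (auto simp: bij_betw_def)
  have FK_ob: "on_ob F (on_ob K b) = b" if "b \<in> Ob B" for b
    using ob_cases[OF that] KF_ob by auto
  have FK_ar: "on_ar F (on_ar K g) = g" if "g \<in> Ar B" for g
    using ar_cases[OF that] KF_ar by auto
  have Dom: "Dom B (on_ar F f) = on_ob F (Dom A f)" "Cod B (on_ar F f) = on_ob F (Cod A f)"
    "Dom A f \<in> Ob A" "Cod A f \<in> Ob A" if "f \<in> Ar A" for f
    using that A F by (auto simp: is_functor_def category_def)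
  have "is_functor B A K"
    unfolding is_functor_def
  proof (intro conjI ballI impI)
    show "on_ob K \<in> Ob B \<rightarrow>\<^sub>E Ob A"
      using ob by (auto simp: K_def bij_betw_def intro: inv_into_into)
    show "on_ar K \<in> Ar B \<rightarrow>\<^sub>E Ar A"
      using ar by (auto simp: K_def bij_betw_def intro: inv_into_into)
  next
    fix g assume "g \<in> Ar B"
    then obtain f where f: "f \<in> Ar A" "g = on_ar F f" using ar_cases by blast
    show "Dom A (on_ar K g) = on_ob K (Dom B g)" "Cod A (on_ar K g) = on_ob K (Cod B g)"
      using f by (simp_all add: KF_ar Dom KF_ob)
  next
    fix b assume "b \<in> Ob B"
    then obtain a where a: "a \<in> Ob A" "b = on_ob F a" using ob_cases by blast
    have "Id B b = on_ar F (Id A a)" "Id A a \<in> Ar A"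
      using a F A by (auto simp: is_functor_def category_def)
    then show "on_ar K (Id B b) = Id A (on_ob K b)"
      using a by (simp add: KF_ar KF_ob)
  next
    fix g h assume "g \<in> Ar B" "h \<in> Ar B" and gh: "Dom B h = Cod B g"
    then obtain f k where fk: "f \<in> Ar A" "g = on_ar F f" "k \<in> Ar A" "h = on_ar F k"
      using ar_cases by metis
    have "on_ob F (Dom A k) = on_ob F (Cod A f)" using gh fk by (simp add: Dom)
    then have eq: "Dom A k = Cod A f" using KF_ob(1) Dom(3,4) fk by metis
    have "Comp B h g = on_ar F (Comp A k f)" "Comp A k f \<in> Ar A"
      using fk eq F A by (auto simp: is_functor_def category_def)
    then show "on_ar K (Comp B h g) = Comp A (on_ar K h) (on_ar K g)"
      using fk by (simp add: KF_ar)
  qed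
  moreover have "comp_functor A K F = id_functor A" "comp_functor B F K = id_functor B"
    using KF_ob KF_ar FK_ob FK_ar
    by (auto simp: comp_functor_def id_functor_def compose_def fun_eq_iff)
  ultimately show ?thesis using F by (auto simp: is_isomorphism_def)
qed

lemma isomorphism_bij_betw_Ob:
  assumes "is_isomorphism A B F"
  shows "bij_betw (on_ob F) (Ob A) (Ob B)"
proof -
  obtain K where F: "is_functor A B F" and K: "is_functor B A K"
    and KF: "comp_functor A K F = id_functor A" and FK: "comp_functor B F K = id_functor B"
    using assms by (auto simp: is_isomorphism_def)
  have "on_ob K (on_ob F a) = a" if "a \<in> Ob A" for a
    using arg_cong[OF KF, of "\<lambda>T. on_ob T a"] that
    by (simp add: comp_functor_def id_functor_def compose_def)
  moreover have "on_ob F (on_ob K b) = b" if "b \<in> Ob B" for b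
    using arg_cong[OF FK, of "\<lambda>T. on_ob T b"] that
    by (simp add: comp_functor_def id_functor_def compose_def)
  ultimately show ?thesis
    using F K by (intro bij_betw_byWitness[where f' = "on_ob K"]) (auto simp: is_functor_def)
qed


section \<open>Monotone maps of finite ordinals\<close>

lemma ordcat_simps [simp]:
  "Ob (ordcat n) = {..n}" "Ar (ordcat n) = {(i, j). i \<le> j \<and> j \<le> n}"
  "Dom (ordcat n) = fst" "Cod (ordcat n) = snd"
  "Id (ordcat n) i = (i, i)" "Comp (ordcat n) g f = (fst f, snd g)"
  by (auto simp: ordcat_def)

lemma category_ordcat: "category (ordcat n)"
  by (auto simp: category_def)

lemma ord_functor_is_functor:
  assumes "\<mu> \<in> delta m n"
  shows "is_functor (ordcat m) (ordcat n) (ord_functor m \<mu>)"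
  using assms by (auto simp: is_functor_def ord_functor_def delta_def mono_on_def Pi_iff PiE_iff)

lemma delta_id_in [simp]: "delta_id n \<in> delta_epi n n" "delta_id n \<in> delta_mono n n"
  by (auto simp: delta_id_def delta_epi_def delta_mono_def delta_def mono_on_def inj_on_def)

text \<open>
  The images of the initial segment up to \<open>i\<close> and of the final segment from \<open>i\<close> lie below and
  above \<open>\<mu> i\<close>; counting them bounds \<open>\<mu> i\<close> by \<open>i\<close> from both sides.
\<close>

lemma delta_endo_inj_eq_id:
  assumes \<mu>: "\<mu> \<in> delta m m" and inj: "inj_on \<mu> {..m}"
  shows "\<mu> = delta_id m"
proof -
  have *: "\<mu> \<in> {..m} \<rightarrow>\<^sub>E {..m}" "mono_on {..m} \<mu>" using \<mu> by (auto simp: delta_def)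
  have "\<mu> i = i" if i: "i \<le> m" for i
  proof (rule antisym)
    have "card (\<mu> ` {..i}) \<le> card {..\<mu> i}"
      using *(2) i by (intro card_mono) (auto simp: mono_on_def)
    moreover have "card (\<mu> ` {..i}) = Suc i"
      using inj_on_subset[OF inj, of "{..i}"] i by (simp add: card_image)
    ultimately show "i \<le> \<mu> i" by simp
    have "card (\<mu> ` {i..m}) \<le> card {\<mu> i..m}"
      using * i by (intro card_mono) (auto simp: mono_on_def PiE_iff)
    moreover have "card (\<mu> ` {i..m}) = Suc m - i"
      using inj_on_subset[OF inj, of "{i..m}"] by (simp add: card_image)
    moreover have "\<mu> i \<le> m" using *(1) i by auto
    ultimately show "\<mu> i \<le> i" using i by simp
  qed
  then show ?thesis
    using *(1) by (auto simp: delta_id_def fun_eq_iff PiE_iff extensional_def)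
qed

lemma delta_epi_le:
  assumes "\<sigma> \<in> delta_epi m n"
  shows "n \<le> m"
proof -
  have "card (\<sigma> ` {..m}) \<le> card {..m}" by (rule card_image_le) simp
  then show ?thesis using assms by (simp add: delta_epi_def)
qed

lemma delta_mono_le:
  assumes "\<nu> \<in> delta_mono m n"
  shows "m \<le> n"
proof -
  have "card {..m} \<le> card {..n}"
    using assms by (intro card_inj_on_le) (auto simp: delta_mono_def delta_def)
  then show ?thesis by simp
qed

lemma delta_epi_endo: "\<sigma> \<in> delta_epi m m \<Longrightarrow> \<sigma> = delta_id m"
  by (rule delta_endo_inj_eq_id) (auto simp: delta_epi_def eq_card_imp_inj_on)

lemma delta_mono_endo: "\<nu> \<in> delta_mono m m \<Longrightarrow> \<nu> = delta_id m"
  by (rule delta_endo_inj_eq_id) (auto simp: delta_mono_def)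


section \<open>Simplices\<close>

lemma pull_apply:
  "sdim (pull m \<mu> x) = m"
  "i \<le> m \<Longrightarrow> on_ob (snd (pull m \<mu> x)) i = on_ob (snd x) (\<mu> i)"
  "i \<le> j \<Longrightarrow> j \<le> m \<Longrightarrow> on_ar (snd (pull m \<mu> x)) (i, j) = on_ar (snd x) (\<mu> i, \<mu> j)"
  by (auto simp: pull_def comp_functor_def compose_def ord_functor_def)

lemma push_apply:
  "sdim (push F x) = sdim x"
  "i \<le> sdim x \<Longrightarrow> on_ob (snd (push F x)) i = on_ob F (on_ob (snd x) i)"
  "i \<le> j \<Longrightarrow> j \<le> sdim x \<Longrightarrow> on_ar (snd (push F x)) (i, j) = on_ar F (on_ar (snd x) (i, j))"
  by (auto simp: push_def comp_functor_def compose_def)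

lemma nerve_iff: "x \<in> nerve C \<longleftrightarrow> is_functor (ordcat (sdim x)) C (snd x)"
  by (cases x) (simp add: nerve_def)

lemma simplex_eqI:
  assumes "x \<in> nerve C" and "y \<in> nerve C" and n: "sdim x = sdim y"
    and "\<And>i. i \<le> sdim y \<Longrightarrow> on_ob (snd x) i = on_ob (snd y) i"
    and "\<And>i j. i \<le> j \<Longrightarrow> j \<le> sdim y \<Longrightarrow> on_ar (snd x) (i, j) = on_ar (snd y) (i, j)"
  shows "x = y"
proof -
  have "snd x = snd y"
    using assms by (intro functor_eqI[of "ordcat (sdim y)" C]) (auto simp: nerve_iff)
  with n show ?thesis by (simp add: prod_eq_iff)
qed

lemma nerveD:
  assumes "x \<in> nerve C"
  shows "i \<le> sdim x \<Longrightarrow> on_ob (snd x) i \<in> Ob C"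
    and "i \<le> j \<Longrightarrow> j \<le> sdim x \<Longrightarrow> on_ar (snd x) (i, j) \<in> Ar C"
    and "i \<le> j \<Longrightarrow> j \<le> sdim x \<Longrightarrow> Dom C (on_ar (snd x) (i, j)) = on_ob (snd x) i"
    and "i \<le> j \<Longrightarrow> j \<le> sdim x \<Longrightarrow> Cod C (on_ar (snd x) (i, j)) = on_ob (snd x) j"
    and "i \<le> sdim x \<Longrightarrow> on_ar (snd x) (i, i) = Id C (on_ob (snd x) i)"
    and "i \<le> j \<Longrightarrow> j \<le> k \<Longrightarrow> k \<le> sdim x \<Longrightarrow>
      on_ar (snd x) (i, k) = Comp C (on_ar (snd x) (j, k)) (on_ar (snd x) (i, j))"
proof -
  let ?I = "ordcat (sdim x)" and ?o = "on_ob (snd x)" and ?a = "on_ar (snd x)"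
  have x: "is_functor ?I C (snd x)" using assms by (simp add: nerve_iff)
  then have ob: "?o \<in> Ob ?I \<rightarrow>\<^sub>E Ob C" and ar: "?a \<in> Ar ?I \<rightarrow>\<^sub>E Ar C"
    and bd: "\<forall>f\<in>Ar ?I. Dom C (?a f) = ?o (fst f) \<and> Cod C (?a f) = ?o (snd f)"
    and id: "\<forall>i\<in>Ob ?I. ?a (i, i) = Id C (?o i)"
    and comp: "\<forall>f\<in>Ar ?I. \<forall>g\<in>Ar ?I. fst g = snd f \<longrightarrow> ?a (fst f, snd g) = Comp C (?a g) (?a f)"
    unfolding is_functor_def ordcat_simps(3-6) by blast+
  show "i \<le> sdim x \<Longrightarrow> ?o i \<in> Ob C" "i \<le> j \<Longrightarrow> j \<le> sdim x \<Longrightarrow> ?a (i, j) \<in> Ar C"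
    using ob ar by auto
  show "i \<le> j \<Longrightarrow> j \<le> sdim x \<Longrightarrow> Dom C (?a (i, j)) = ?o i"
    "i \<le> j \<Longrightarrow> j \<le> sdim x \<Longrightarrow> Cod C (?a (i, j)) = ?o j"
    using bd by auto
  show "i \<le> sdim x \<Longrightarrow> ?a (i, i) = Id C (?o i)" using id by auto
  assume "i \<le> j" "j \<le> k" "k \<le> sdim x"
  then show "?a (i, k) = Comp C (?a (j, k)) (?a (i, j))"
    using comp[rule_format, of "(i, j)" "(j, k)"] by simp
qed

lemma pull_nerve:
  assumes "x \<in> nerve C" and "\<mu> \<in> delta m (sdim x)"
  shows "pull m \<mu> x \<in> nerve C"
  using comp_functor_is_functor[OF category_ordcat ord_functor_is_functor[OF assms(2)], of C "snd x"]
    assms(1) by (simp add: nerve_iff pull_def)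

lemma push_nerve:
  assumes "is_functor B C F" and "x \<in> nerve B"
  shows "push F x \<in> nerve C"
  using comp_functor_is_functor[OF category_ordcat _ assms(1)] assms(2)
  by (simp add: nerve_iff push_def)

lemma pull_id:
  assumes "x \<in> nerve C"
  shows "pull (sdim x) (delta_id (sdim x)) x = x"
proof (rule simplex_eqI[OF pull_nerve assms])
  show "delta_id (sdim x) \<in> delta (sdim x) (sdim x)"
    using delta_id_in(1) by (auto simp: delta_epi_def)
qed (use assms in \<open>auto simp: pull_apply delta_id_def\<close>)

lemma simplex0_apply [simp]:
  "sdim (simplex0 C a) = 0"
  "on_ob (snd (simplex0 C a)) 0 = a"
  "on_ar (snd (simplex0 C a)) (0, 0) = Id C a"
  by (simp_all add: simplex0_def)

lemma simplex1_apply [simp]: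
  "sdim (simplex1 C f) = 1"
  "on_ob (snd (simplex1 C f)) 0 = Dom C f"
  "on_ob (snd (simplex1 C f)) (Suc 0) = Cod C f"
  "on_ar (snd (simplex1 C f)) (0, Suc 0) = f"
  "on_ar (snd (simplex1 C f)) (0, 0) = Id C (Dom C f)"
  "on_ar (snd (simplex1 C f)) (Suc 0, Suc 0) = Id C (Cod C f)"
  by (simp_all add: simplex1_def)

lemma simplex0_nerve:
  assumes "category C" and a: "a \<in> Ob C"
  shows "simplex0 C a \<in> nerve C"
proof -
  have "Id C a \<in> Ar C" "Dom C (Id C a) = a" "Cod C (Id C a) = a" using assms by (auto simp: category_def)
  moreover from this have "Comp C (Id C a) (Id C a) = Id C a"
    using assms(1) unfolding category_def by metis
  ultimately show ?thesis
    using a by (auto simp: nerve_iff simplex0_def is_functor_def)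
qed

lemma simplex1_nerve:
  assumes C: "category C" and f: "f \<in> Ar C"
  shows "simplex1 C f \<in> nerve C"
proof -
  have ob: "Dom C f \<in> Ob C" "Cod C f \<in> Ob C" using assms by (auto simp: category_def)
  have Id: "Id C a \<in> Ar C \<and> Dom C (Id C a) = a \<and> Cod C (Id C a) = a" if "a \<in> Ob C" for a
    using C that by (auto simp: category_def)
  have unit: "Comp C g (Id C (Dom C g)) = g \<and> Comp C (Id C (Cod C g)) g = g" if "g \<in> Ar C" for g
    using C that by (auto simp: category_def)
  have IdId: "Comp C (Id C a) (Id C a) = Id C a" if "a \<in> Ob C" for a
    using unit Id that by metis
  have ob1: "Ob (ordcat 1) = {0, 1}" by auto
  have ar1: "Ar (ordcat 1) = {(0, 0), (0, 1), (1, 1)}" by (auto simp: le_Suc_eq)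
  show ?thesis
    unfolding nerve_iff is_functor_def simplex1_def fst_conv snd_conv cat_map.simps ob1 ar1
    using ob f Id[OF ob(1)] Id[OF ob(2)] unit[OF f] IdId[OF ob(1)] IdId[OF ob(2)]
    by (simp del: ordcat_simps(1,2))
qed

lemma simplex_dim0_eq:
  assumes "x \<in> nerve C" and "category C" and "sdim x = 0"
  shows "x = simplex0 C (on_ob (snd x) 0)"
  using assms by (intro simplex_eqI[OF _ simplex0_nerve]) (auto simp: nerveD(1-5))

lemma simplex_dim1_eq:
  assumes "x \<in> nerve C" and "category C" and "sdim x = 1"
  shows "x = simplex1 C (on_ar (snd x) (0, 1))"
proof -
  have le1: "j \<le> Suc 0 \<longleftrightarrow> j = 0 \<or> j = Suc 0" for j by auto
  show ?thesis
    using assms by (intro simplex_eqI[OF _ simplex1_nerve]) (auto simp: nerveD(1-5) le1)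
qed

lemma push_simplex0:
  assumes "category B" and "category C" and F: "is_functor B C F" and "a \<in> Ob B"
  shows "push F (simplex0 B a) = simplex0 C (on_ob F a)"
  using simplex_dim0_eq[OF push_nerve[OF F simplex0_nerve] \<open>category C\<close>, of a] assms
  by (simp add: push_apply)

lemma push_simplex1:
  assumes "category B" and "category C" and F: "is_functor B C F" and "f \<in> Ar B"
  shows "push F (simplex1 B f) = simplex1 C (on_ar F f)"
  using simplex_dim1_eq[OF push_nerve[OF F simplex1_nerve] \<open>category C\<close>, of f] assms
  by (simp add: push_apply)


section \<open>Degeneracy and roots in low dimension\<close>

lemma nondegenerateD:
  assumes "y \<in> nondegenerate_simplices C" and x: "x \<in> nerve C"
    and "\<sigma> \<in> delta_epi (sdim y) (sdim x)" and "pull (sdim y) \<sigma> x = y"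
  shows "x = y"
proof -
  have "sdim x = sdim y" "\<sigma> = delta_id (sdim y)"
    using assms unfolding nondegenerate_simplices_def degenerate_def mem_Collect_eq by metis+
  with assms pull_id[OF x] show ?thesis by simp
qed

lemma root_nondegenerate:
  assumes y: "y \<in> nondegenerate_simplices C"
  shows "root C y = y"
  unfolding root_def
proof (rule the_equality)
  show "y \<in> nondegenerate_simplices C \<and> (\<exists>\<sigma>\<in>delta_epi (sdim y) (sdim y). pull (sdim y) \<sigma> y = y)"
    using y pull_id[of y C] delta_id_in(1)[of "sdim y"]
    by (auto simp: nondegenerate_simplices_def)
next
  fix x assume "x \<in> nondegenerate_simplices C \<and> (\<exists>\<sigma>\<in>delta_epi (sdim y) (sdim x). pull (sdim y) \<sigma> x = y)"
  then show "x = y"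
    using nondegenerateD[OF y, of x] by (auto simp: nondegenerate_simplices_def)
qed

lemma simplex0_nondegenerate:
  assumes "category C" and "a \<in> Ob C"
  shows "simplex0 C a \<in> nondegenerate_simplices C"
  using simplex0_nerve[OF assms] delta_epi_le delta_epi_endo
  by (fastforce simp: nondegenerate_simplices_def degenerate_def)

text \<open>
  An epimorphism out of \<open>[1]\<close> that is not the identity is the collapse to \<open>[0]\<close>, and a simplex
  pulled back along it only has identity arrows.
\<close>

lemma simplex1_nondegenerate:
  assumes "category C" and f: "f \<in> Ar C - Id C ` Ob C"
  shows "simplex1 C f \<in> nondegenerate_simplices C"
proof -
  have "\<not> degenerate C (simplex1 C f)"
  proof
    assume "degenerate C (simplex1 C f)"
    then obtain x \<sigma> where x: "x \<in> nerve C" and \<sigma>: "\<sigma> \<in> delta_epi 1 (sdim x)"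
      and nid: "\<not> (sdim x = 1 \<and> \<sigma> = delta_id 1)" and eq: "simplex1 C f = pull 1 \<sigma> x"
      unfolding degenerate_def by auto
    have dim: "sdim x = 0"
      using delta_epi_le[OF \<sigma>] delta_epi_endo[of \<sigma> 1] \<sigma> nid by (cases "sdim x = 1") auto
    then have "\<sigma> 0 = 0" "\<sigma> 1 = 0" using \<sigma> by (auto simp: delta_epi_def)
    then have "f = on_ar (snd x) (0, 0)"
      using arg_cong[OF eq, of "\<lambda>y. on_ar (snd y) (0, 1)"] by (simp add: pull_apply)
    then show False using f nerveD(1,5)[OF x, of 0] by auto
  qed
  then show ?thesis
    using simplex1_nerve[OF assms(1)] f by (simp add: nondegenerate_simplices_def)
qed

text \<open>
  If the first arrow is an identity, dropping vertex \<open>0\<close> and then repeating vertex \<open>1\<close> recovers the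
  simplex.
\<close>

lemma degenerate_if_first_arrow_identity:
  assumes C: "category C" and x: "x \<in> nerve C" and dim: "sdim x = Suc n"
    and a: "a \<in> Ob C" and id: "on_ar (snd x) (0, 1) = Id C a"
  shows "degenerate C x"
proof -
  define d where "d = (\<lambda>i\<in>{..n}. Suc i)"
  define s where "s = (\<lambda>i\<in>{..Suc n}. i - 1)"
  have d: "d \<in> delta n (Suc n)" by (auto simp: d_def delta_def mono_on_def)
  have "s ` {..Suc n} = {..n}"
  proof
    show "{..n} \<subseteq> s ` {..Suc n}"
      by (rule subsetI, rule_tac x = "Suc x" in image_eqI) (auto simp: s_def)
  qed (auto simp: s_def)
  then have s: "s \<in> delta_epi (Suc n) n" by (auto simp: s_def delta_epi_def delta_def mono_on_def)
  have dx: "pull n d x \<in> nerve C" using x d dim by (simp add: pull_nerve)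
  have a01: "on_ob (snd x) 0 = a" "on_ob (snd x) 1 = a"
    using nerveD(3,4)[OF x, of 0 1] C a id dim by (auto simp: category_def)
  have ds: "d (s i) = max 1 i" if "i \<le> Suc n" for i
    using that by (auto simp: d_def s_def)
  have s_le: "s i \<le> n" if "i \<le> Suc n" for i using that by (auto simp: s_def)
  have s_mono: "s i \<le> s j" if "i \<le> j" "j \<le> Suc n" for i j using that by (auto simp: s_def)
  have "x = pull (Suc n) s (pull n d x)"
  proof (rule simplex_eqI[OF x])
    show "pull (Suc n) s (pull n d x) \<in> nerve C"
      using s by (intro pull_nerve[OF dx]) (auto simp: pull_apply delta_epi_def)
    show "sdim x = sdim (pull (Suc n) s (pull n d x))" by (simp add: dim pull_apply)
  next
    fix i assume "i \<le> sdim (pull (Suc n) s (pull n d x))"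
    then show "on_ob (snd x) i = on_ob (snd (pull (Suc n) s (pull n d x))) i"
      using a01 by (cases i) (simp_all add: pull_apply ds s_le)
  next
    fix i j assume ij: "i \<le> j" "j \<le> sdim (pull (Suc n) s (pull n d x))"
    then have j: "j \<le> Suc n" by (simp add: pull_apply)
    have "on_ar (snd x) (i, j) = on_ar (snd x) (max 1 i, max 1 j)"
    proof (cases "i = 0 \<and> j \<noteq> 0")
      case True
      then have arr: "on_ar (snd x) (1, j) \<in> Ar C" "Dom C (on_ar (snd x) (1, j)) = a"
        using nerveD(2,3)[OF x, of 1 j] j dim a01 by auto
      have "on_ar (snd x) (0, j) = Comp C (on_ar (snd x) (1, j)) (on_ar (snd x) (0, 1))"
        using nerveD(6)[OF x, of 0 1 j] True j dim by simp
      also have "\<dots> = on_ar (snd x) (1, j)"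
        using C arr id by (auto simp: category_def)
      finally show ?thesis using True by (simp add: max_def)
    next
      case False
      then show ?thesis
        using nerveD(5)[OF x, of 0] nerveD(5)[OF x, of 1] a01 dim ij by (auto simp: max_def)
    qed
    then show "on_ar (snd x) (i, j) = on_ar (snd (pull (Suc n) s (pull n d x))) (i, j)"
      using ij j by (simp add: pull_apply ds s_le s_mono)
  qed
  then show ?thesis
    using dx s unfolding degenerate_def
    by (intro bexI[of _ "pull n d x"] bexI[of _ s]) (auto simp: pull_apply dim)
qed

lemma first_arrow_not_identity:
  assumes "category C" and "x \<in> nondegenerate_simplices C" and "sdim x \<noteq> 0"
  shows "on_ar (snd x) (0, 1) \<in> Ar C - Id C ` Ob C"
proof -
  have x: "x \<in> nerve C" "\<not> degenerate C x" using assms(2) by (auto simp: nondegenerate_simplices_def)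
  obtain n where n: "sdim x = Suc n" using assms(3) not0_implies_Suc by blast
  show ?thesis
    using degenerate_if_first_arrow_identity[OF assms(1) x(1) n] x nerveD(2)[OF x(1), of 0 1] n
    by auto
qed

text \<open>
  Uniqueness of the root is immediate here because a candidate has dimension \<open>0\<close> or \<open>1\<close>, and in
  dimension \<open>1\<close> it would be the degenerate simplex itself.
\<close>

lemma root_simplex1_Id:
  assumes C: "category C" and a: "a \<in> Ob C"
  shows "root C (simplex1 C (Id C a)) = simplex0 C a"
proof -
  let ?y = "simplex1 C (Id C a)"
  have Id: "Id C a \<in> Ar C" "Dom C (Id C a) = a" using C a by (auto simp: category_def)
  have y: "?y \<in> nerve C" "degenerate C ?y"
    using simplex1_nerve[OF C Id(1)] degenerate_if_first_arrow_identity[OF C _ _ a, of ?y 0] by auto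
  show ?thesis
    unfolding root_def
  proof (rule the_equality)
    define z where "z = (\<lambda>i\<in>{..1::nat}. 0::nat)"
    have z: "z \<in> delta_epi 1 0" by (auto simp: z_def delta_epi_def delta_def mono_on_def)
    have "pull 1 z (simplex0 C a) \<in> nerve C"
      using z simplex0_nerve[OF C a] by (intro pull_nerve) (auto simp: delta_epi_def)
    then have "pull 1 z (simplex0 C a) = ?y"
      using simplex_dim1_eq[OF _ C, of "pull 1 z (simplex0 C a)"] by (simp add: pull_apply z_def)
    then show "simplex0 C a \<in> nondegenerate_simplices C \<and>
        (\<exists>\<sigma>\<in>delta_epi (sdim ?y) (sdim (simplex0 C a)). pull (sdim ?y) \<sigma> (simplex0 C a) = ?y)"
      using z simplex0_nondegenerate[OF C a] by auto
  next
    fix x assume "x \<in> nondegenerate_simplices C \<and>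
        (\<exists>\<sigma>\<in>delta_epi (sdim ?y) (sdim x). pull (sdim ?y) \<sigma> x = ?y)"
    then obtain \<sigma> where x: "x \<in> nerve C" "\<not> degenerate C x"
      and \<sigma>: "\<sigma> \<in> delta_epi 1 (sdim x)" and eq: "pull 1 \<sigma> x = ?y"
      by (auto simp: nondegenerate_simplices_def)
    have "sdim x \<noteq> 1"
    proof
      assume "sdim x = 1"
      then have "x = ?y" using \<sigma> eq delta_epi_endo[of \<sigma> 1] pull_id[OF x(1)] by simp
      then show False using x(2) y(2) by simp
    qed
    then have dim: "sdim x = 0" using delta_epi_le[OF \<sigma>] by simp
    then have "\<sigma> 0 = 0" using \<sigma> by (auto simp: delta_epi_def)
    then have "on_ob (snd x) 0 = a"
      using arg_cong[OF eq, of "\<lambda>y. on_ob (snd y) 0"] Id(2) by (simp add: pull_apply)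
    then show "x = simplex0 C a" using simplex_dim0_eq[OF x(1) C dim] by simp
  qed
qed


section \<open>Arrows of the subdivision\<close>

lemma Sd_simps [simp]:
  "Ob (Sd C) = nondegenerate_simplices C" "Ar (Sd C) = sd_arrows C"
  "Dom (Sd C) = sd_src" "Cod (Sd C) = sd_tgt"
  by (simp_all add: Sd_def)

lemma face_arrow:
  assumes "x \<in> nondegenerate_simplices C" and "\<nu> \<in> delta_mono m (sdim x)"
    and face: "pull m \<nu> x \<in> nondegenerate_simplices C"
  shows "\<exists>f\<in>sd_arrows C. sd_src f = pull m \<nu> x \<and> sd_tgt f = x"
proof -
  have "pull m (delta_id m) (pull m \<nu> x) = pull m \<nu> x"
    using pull_id[of "pull m \<nu> x" C] face by (simp add: pull_apply nondegenerate_simplices_def)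
  then show ?thesis
    using assms delta_id_in(1)[of m]
    by (intro bexI[of _ "\<lparr>sd_src = pull m \<nu> x, sd_tgt = x, sd_apex = m, sd_epi = delta_id m, sd_mono = \<nu>\<rparr>"])
      (auto simp: sd_arrows_def pull_apply)
qed

text \<open>
  The apex dimension of an arrow is at least that of its source and at most that of its target; if
  these two agree, both legs are identities.
\<close>

lemma sd_arrow_same_dim:
  assumes f: "f \<in> sd_arrows C" and dim: "sdim (sd_src f) = sdim (sd_tgt f)"
  shows "sd_src f = sd_tgt f"
proof -
  let ?k = "sd_apex f"
  have \<sigma>: "sd_epi f \<in> delta_epi ?k (sdim (sd_src f))" and \<nu>: "sd_mono f \<in> delta_mono ?k (sdim (sd_tgt f))"
    and eq: "pull ?k (sd_epi f) (sd_src f) = pull ?k (sd_mono f) (sd_tgt f)"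
    and ner: "sd_src f \<in> nerve C" "sd_tgt f \<in> nerve C"
    using f by (auto simp: sd_arrows_def nondegenerate_simplices_def)
  have k: "?k = sdim (sd_src f)" "?k = sdim (sd_tgt f)"
    using delta_epi_le[OF \<sigma>] delta_mono_le[OF \<nu>] dim by auto
  have "sd_epi f = delta_id ?k" "sd_mono f = delta_id ?k"
    using delta_epi_endo[of "sd_epi f" ?k] delta_mono_endo[of "sd_mono f" ?k] \<sigma> \<nu> k by auto
  then show ?thesis using eq pull_id[OF ner(1)] pull_id[OF ner(2)] k by simp
qed

text \<open>
  This recovers the image of \<open>x\<close> from the image of one of its faces, which makes it possible to
  locate a preimage of a low-dimensional simplex without knowing the dimension of that preimage.
\<close>

lemma functor_Sd_face:
  assumes P: "is_functor (Sd B) (Sd C) P"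
    and "x \<in> nondegenerate_simplices B" and "\<nu> \<in> delta_mono m (sdim x)"
    and "pull m \<nu> x \<in> nondegenerate_simplices B"
    and dim: "sdim (on_ob P (pull m \<nu> x)) = sdim (on_ob P x)"
  shows "on_ob P (pull m \<nu> x) = on_ob P x"
proof -
  obtain f where f: "f \<in> sd_arrows B" "sd_src f = pull m \<nu> x" "sd_tgt f = x"
    using face_arrow[OF assms(2-4)] by blast
  then have "on_ar P f \<in> sd_arrows C" "sd_src (on_ar P f) = on_ob P (pull m \<nu> x)"
    "sd_tgt (on_ar P f) = on_ob P x"
    using P by (auto simp: is_functor_def)
  then show ?thesis using sd_arrow_same_dim[of "on_ar P f" C] dim by simp
qed


section \<open>Functors whose subdivision is an isomorphism\<close>

lemma Sd_map_simplex0: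
  assumes "category B" and "category C" and F: "is_functor B C F" and a: "a \<in> Ob B"
  shows "on_ob (Sd_map B C F) (simplex0 B a) = simplex0 C (on_ob F a)"
proof -
  have "on_ob F a \<in> Ob C" using F a by (auto simp: is_functor_def)
  then show ?thesis
    using assms
    by (simp add: Sd_map_def simplex0_nondegenerate push_simplex0 root_nondegenerate)
qed

text \<open>
  Collapsing a non-identity arrow would give its 1-simplex and its source vertex the same image.
\<close>

lemma Sd_map_inj_reflects_identities:
  assumes B: "category B" and C: "category C" and F: "is_functor B C F"
    and inj: "inj_on (on_ob (Sd_map B C F)) (nondegenerate_simplices B)"
    and f: "f \<in> Ar B - Id B ` Ob B"
  shows "on_ar F f \<in> Ar C - Id C ` Ob C"
proof -
  have dom: "Dom B f \<in> Ob B" using B f by (auto simp: category_def)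
  have Ff: "on_ar F f \<in> Ar C" "Dom C (on_ar F f) = on_ob F (Dom B f)"
    using F f by (auto simp: is_functor_def)
  have "on_ar F f \<notin> Id C ` Ob C"
  proof
    assume "on_ar F f \<in> Id C ` Ob C"
    then obtain c where c: "c \<in> Ob C" "on_ar F f = Id C c" by blast
    then have c_eq: "c = on_ob F (Dom B f)" using Ff(2) C by (auto simp: category_def)
    have "on_ob (Sd_map B C F) (simplex1 B f) = simplex0 C c"
      using B C F f c
      by (simp add: Sd_map_def simplex1_nondegenerate push_simplex1 root_simplex1_Id)
    also have "\<dots> = on_ob (Sd_map B C F) (simplex0 B (Dom B f))"
      using Sd_map_simplex0[OF B C F dom] c_eq by simp
    finally have "simplex1 B f = simplex0 B (Dom B f)"
      using inj_onD[OF inj] simplex1_nondegenerate[OF B f] simplex0_nondegenerate[OF B dom] by blast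
    then have "sdim (simplex1 B f) = sdim (simplex0 B (Dom B f))" by simp
    then show False by simp
  qed
  then show ?thesis using Ff by blast
qed

lemma Sd_map_simplex1:
  assumes B: "category B" and C: "category C" and F: "is_functor B C F"
    and inj: "inj_on (on_ob (Sd_map B C F)) (nondegenerate_simplices B)"
    and f: "f \<in> Ar B - Id B ` Ob B"
  shows "on_ob (Sd_map B C F) (simplex1 B f) = simplex1 C (on_ar F f)"
  using simplex1_nondegenerate[OF C Sd_map_inj_reflects_identities[OF assms]] assms
  by (simp add: Sd_map_def simplex1_nondegenerate push_simplex1 root_nondegenerate)

lemma simplex0_eq_iff: "simplex0 C a = simplex0 C b \<longleftrightarrow> a = b"
  by (metis simplex0_apply(2))

lemma simplex1_eq_iff: "simplex1 C f = simplex1 C g \<longleftrightarrow> f = g"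
  by (metis simplex1_apply(4))

lemma induced_map_Sd_map:
  assumes B: "category B" and C: "category C" and F: "is_functor B C F"
    and inj: "inj_on (on_ob (Sd_map B C F)) (nondegenerate_simplices B)"
  shows "induced_map B C (Sd_map B C F) = F"
  unfolding induced_map_def
proof (rule the_equality)
  show ind: "is_induced_map B C (Sd_map B C F) F"
    using F Sd_map_simplex0[OF B C F] Sd_map_simplex1[OF B C F inj]
    by (auto simp: is_induced_map_def is_functor_def)
  fix \<psi> assume \<psi>: "is_induced_map B C (Sd_map B C F) \<psi>"
  have ob: "on_ob \<psi> b = on_ob F b" if "b \<in> Ob B" for b
    using ind \<psi> that unfolding is_induced_map_def by (metis simplex0_eq_iff)
  moreover have ar: "on_ar \<psi> f = on_ar F f" if f: "f \<in> Ar B" for f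
  proof (cases "f \<in> Id B ` Ob B")
    case True
    then show ?thesis using ind \<psi> ob unfolding is_induced_map_def by auto
  next
    case False
    then have "simplex1 C (on_ar \<psi> f) = simplex1 C (on_ar F f)"
      using ind \<psi> f unfolding is_induced_map_def by (metis DiffI)
    then show ?thesis by (simp add: simplex1_eq_iff)
  qed
  ultimately have "on_ob \<psi> = on_ob F" "on_ar \<psi> = on_ar F"
    using ind \<psi> by (auto simp: is_induced_map_def intro: PiE_ext)
  then show "\<psi> = F" by (cases \<psi>, cases F) simp
qed

lemma isomorphism_if_Sd_map_isomorphism:
  assumes B: "category B" and C: "category C" and F: "is_functor B C F"
    and iso: "is_isomorphism (Sd B) (Sd C) (Sd_map B C F)"
  shows "is_isomorphism B C F"
proof -
  let ?P = "Sd_map B C F"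
  have P: "is_functor (Sd B) (Sd C) ?P" using iso by (simp add: is_isomorphism_def)
  have inj: "inj_on (on_ob ?P) (nondegenerate_simplices B)"
    and surj: "on_ob ?P ` nondegenerate_simplices B = nondegenerate_simplices C"
    using isomorphism_bij_betw_Ob[OF iso] by (auto simp: bij_betw_def)
  note P0 = Sd_map_simplex0[OF B C F] and P1 = Sd_map_simplex1[OF B C F inj]
    and nonid = Sd_map_inj_reflects_identities[OF B C F inj]
  have F_ob: "on_ob F a \<in> Ob C" if "a \<in> Ob B" for a using F that by (auto simp: is_functor_def)
  have F_id: "on_ar F (Id B a) = Id C (on_ob F a)" if "a \<in> Ob B" for a
    using F that by (auto simp: is_functor_def)
  have F_ar: "on_ar F f \<in> Ar C" if "f \<in> Ar B" for f using F that by (auto simp: is_functor_def)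
  have nerve: "x \<in> nerve B" if "x \<in> nondegenerate_simplices B" for x
    using that by (simp add: nondegenerate_simplices_def)

  have inj_ob: "inj_on (on_ob F) (Ob B)"
  proof (rule inj_onI)
    fix a b assume ab: "a \<in> Ob B" "b \<in> Ob B" "on_ob F a = on_ob F b"
    then have "simplex0 B a = simplex0 B b"
      using P0 simplex0_nondegenerate[OF B] by (intro inj_onD[OF inj]) auto
    then show "a = b" by (simp add: simplex0_eq_iff)
  qed
  have surj_ob: "c \<in> on_ob F ` Ob B" if c: "c \<in> Ob C" for c
  proof -
    obtain x where x: "x \<in> nondegenerate_simplices B" "on_ob ?P x = simplex0 C c"
      using surj simplex0_nondegenerate[OF C c] by (metis imageE)
    let ?a = "on_ob (snd x) 0" and ?\<nu> = "\<lambda>i\<in>{..0::nat}. 0::nat"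
    have a: "?a \<in> Ob B" using nerveD(1)[OF nerve[OF x(1)], of 0] by simp
    have \<nu>: "?\<nu> \<in> delta_mono 0 (sdim x)" by (auto simp: delta_mono_def delta_def mono_on_def)
    then have "pull 0 ?\<nu> x \<in> nerve B"
      using nerve[OF x(1)] by (intro pull_nerve) (auto simp: delta_mono_def)
    then have face: "pull 0 ?\<nu> x = simplex0 B ?a"
      using simplex_dim0_eq[OF _ B, of "pull 0 ?\<nu> x"] by (simp add: pull_apply)
    have "simplex0 C (on_ob F ?a) = simplex0 C c"
      using functor_Sd_face[OF P x(1) \<nu>] x(2)
      by (simp only: face P0[OF a] simplex0_nondegenerate[OF B a] simplex0_apply)
    then show ?thesis using a by (auto simp: simplex0_eq_iff)
  qed

  have inj_ar: "inj_on (on_ar F) (Ar B)"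
  proof (rule inj_onI)
    fix f g assume fg: "f \<in> Ar B" "g \<in> Ar B" "on_ar F f = on_ar F g"
    show "f = g"
    proof (cases "f \<in> Id B ` Ob B")
      case True
      then obtain a where a: "a \<in> Ob B" "f = Id B a" by blast
      then have "on_ar F g \<in> Id C ` Ob C" using fg F_id F_ob by (metis imageI)
      then have "g \<in> Id B ` Ob B" using nonid fg by blast
      then obtain b where b: "b \<in> Ob B" "g = Id B b" by blast
      then have "Id C (on_ob F a) = Id C (on_ob F b)" using a fg F_id by auto
      then have "on_ob F a = on_ob F b" using F_ob[OF a(1)] F_ob[OF b(1)] C unfolding category_def by metis
      then show ?thesis using a b inj_onD[OF inj_ob] by blast
    next
      case False
      then have f: "f \<in> Ar B - Id B ` Ob B" using fg by blast
      then have g: "g \<in> Ar B - Id B ` Ob B" using nonid[OF f] fg F_id F_ob by auto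
      have "simplex1 B f = simplex1 B g"
        using P1 fg f g simplex1_nondegenerate[OF B] by (intro inj_onD[OF inj]) auto
      then show ?thesis by (simp add: simplex1_eq_iff)
    qed
  qed
  have surj_ar: "h \<in> on_ar F ` Ar B" if h: "h \<in> Ar C" for h
  proof (cases "h \<in> Id C ` Ob C")
    case True
    then obtain a where "a \<in> Ob B" "h = Id C (on_ob F a)" using surj_ob by blast
    then show ?thesis using F_id B by (auto simp: category_def intro!: image_eqI[of _ _ "Id B a"])
  next
    case False
    then have h: "h \<in> Ar C - Id C ` Ob C" using h by blast
    obtain x where x: "x \<in> nondegenerate_simplices B" "on_ob ?P x = simplex1 C h"
      using surj simplex1_nondegenerate[OF C h] by (metis imageE)
    have dim: "sdim x \<noteq> 0"
    proof
      assume "sdim x = 0"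
      then have "x = simplex0 B (on_ob (snd x) 0)" "on_ob (snd x) 0 \<in> Ob B"
        using simplex_dim0_eq[OF nerve[OF x(1)] B] nerveD(1)[OF nerve[OF x(1)], of 0] by auto
      then have "sdim (on_ob ?P x) = 0" using P0 by (metis simplex0_apply(1))
      then show False using x(2) by simp
    qed
    let ?f = "on_ar (snd x) (0, 1)" and ?\<nu> = "\<lambda>i\<in>{..1::nat}. i"
    have f: "?f \<in> Ar B - Id B ` Ob B" using first_arrow_not_identity[OF B x(1) dim] .
    have \<nu>: "?\<nu> \<in> delta_mono 1 (sdim x)"
      using dim by (auto simp: delta_mono_def delta_def mono_on_def inj_on_def)
    then have "pull 1 ?\<nu> x \<in> nerve B"
      using nerve[OF x(1)] by (intro pull_nerve) (auto simp: delta_mono_def)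
    then have face: "pull 1 ?\<nu> x = simplex1 B ?f"
      using simplex_dim1_eq[OF _ B, of "pull 1 ?\<nu> x"] by (simp add: pull_apply)
    have "simplex1 C (on_ar F ?f) = simplex1 C h"
      using functor_Sd_face[OF P x(1) \<nu>] x(2)
      by (simp only: face P1[OF f] simplex1_nondegenerate[OF B f] simplex1_apply)
    then show ?thesis using f by (auto simp: simplex1_eq_iff)
  qed

  have "on_ob F ` Ob B = Ob C" "on_ar F ` Ar B = Ar C"
    using surj_ob surj_ar F_ob F_ar by blast+
  then show ?thesis
    using inj_ob inj_ar by (intro bijective_functor_is_isomorphism[OF B F]) (auto simp: bij_betw_def)
qed

theorem mainTheorem2:
  fixes G :: "('o, 'a) cat" and H :: "('p, 'b) cat"
    and F :: "('o, 'a, 'p, 'b) cat_map"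
    and \<Psi> :: "(('o, 'a) simplex, ('o, 'a) sd_arrow, ('p, 'b) simplex, ('p, 'b) sd_arrow) cat_map"
    and \<psi> :: "('o, 'a, 'p, 'b) cat_map"
  assumes "groupoid G" and "groupoid H"
    and "is_functor G H F"
    and "\<Psi> = Sd_map G H F"
    and "is_isomorphism (Sd G) (Sd H) \<Psi>"
    and "\<psi> = induced_map G H \<Psi>"
  shows "(\<forall>a\<in>Ob G. on_ob \<psi> a = on_ob F a) \<and> (\<forall>g\<in>Ar G. on_ar \<psi> g = on_ar F g) \<and>
         is_isomorphism G H F"
proof -
  have G: "category G" and H: "category H" using assms(1,2) by (simp_all add: groupoid_def)
  have "inj_on (on_ob (Sd_map G H F)) (nondegenerate_simplices G)"
    using isomorphism_bij_betw_Ob[OF assms(5)] assms(4) by (simp add: bij_betw_def)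
  then have "\<psi> = F" using induced_map_Sd_map[OF G H assms(3)] assms(4,6) by simp
  then show ?thesis
    using isomorphism_if_Sd_map_isomorphism[OF G H assms(3)] assms(4,5) by simp
qed

end
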